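(* Let $k\neq0$ be a constant and let $R$ be a rotational surface in $\mathbb{E}^3$ given by $\Phi(s,\theta)=(f(s)\cos\theta,f(s)\sin\theta,g(s))$ with $f'^2+g'^2=1$, whose principal curvatures satisfy $\kappa_1=k\kappa_2$. Let $$\alpha(t)=\big(f(s(t))\cos\theta(t),\ f(s(t))\sin\theta(t),\ g(s(t))\big),\quad s(t)=(\cos\psi)t+c,\quad \theta(t)=\varepsilon\sin\psi\int_{t_0}^{t}\frac{d\xi}{f(s(\xi))}$$ be a loxodrome on $R$, where $\psi\in[0,\pi]$, $\varepsilon=\pm1$, $c,t_0$ are constants, and put $a=\cos\psi$, $b=\varepsilon\sin\psi$. Then there is a positive constant $d$ such that the curvature and (where $\kappa\ne0$) the torsion of $\alpha$ are $$\kappa=\frac{\sqrt{b^2+d^2a^2(a^2k^2+2kb^2-b^2)f^{2k}}}{f},$$ $$\tau=\pm\frac{abd}{\kappa^2f^{3-k}}\Big(b^2+a^2k^2-d^2\big(a^2b^2+(a^4-2a^2b^2-a^2)k+(2a^2-3a^4)k^2+a^4k^3\big)f^{2k}\Big),$$ where $f$ denotes $f(s(t))$.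
   Context: $f,g$ are smooth functions on an open interval with $f>0$ and $f'^2<1$. The principal curvatures of $R$ (along the meridian direction $\Phi_s$ and the parallel direction $\Phi_\theta$ respectively) are $\kappa_1=-f''/\sqrt{1-f'^2}$ and $\kappa_2=\sqrt{1-f'^2}/f$. For a regular curve, $\kappa=\|\dot\alpha\times\ddot\alpha\|/\|\dot\alpha\|^3$ and $\tau=\det(\dot\alpha,\ddot\alpha,\dddot\alpha)/\|\dot\alpha\times\ddot\alpha\|^2$. The sign $\pm$ in $\tau$ is constant along $\alpha$ (it depends on the sign of $g'$). *)

theory Defs
  imports "HOL-Analysis.Analysis"
begin

definition smooth_on :: "real set \<Rightarrow> (real \<Rightarrow> real) \<Rightarrow> bool" where
  "smooth_on I f \<longleftrightarrow> (\<forall>n. \<forall>x\<in>I. ((deriv ^^ n) f) field_differentiable (at x))"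


subsection \<open>Space curves\<close>

definition curve_deriv :: "nat \<Rightarrow> (real \<Rightarrow> real^3) \<Rightarrow> real \<Rightarrow> real^3" where
  "curve_deriv n \<alpha> = ((\<lambda>\<beta> t. vector_derivative \<beta> (at t)) ^^ n) \<alpha>"

definition curvature :: "(real \<Rightarrow> real^3) \<Rightarrow> real \<Rightarrow> real" where
  "curvature \<alpha> t =
     norm (cross3 (curve_deriv 1 \<alpha> t) (curve_deriv 2 \<alpha> t)) / norm (curve_deriv 1 \<alpha> t) ^ 3"

definition torsion :: "(real \<Rightarrow> real^3) \<Rightarrow> real \<Rightarrow> real" where
  "torsion \<alpha> t =
     det (vector [curve_deriv 1 \<alpha> t, curve_deriv 2 \<alpha> t, curve_deriv 3 \<alpha> t] :: real^3^3) /
     (norm (cross3 (curve_deriv 1 \<alpha> t) (curve_deriv 2 \<alpha> t)))\<^sup>2"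


subsection \<open>Rotational surfaces and their principal curvatures\<close>

definition rot_surface :: "(real \<Rightarrow> real) \<Rightarrow> (real \<Rightarrow> real) \<Rightarrow> real \<Rightarrow> real \<Rightarrow> real^3" where
  "rot_surface f g s \<theta> = vector [f s * cos \<theta>, f s * sin \<theta>, g s]"

text \<open>
  These are the principal curvatures, along the meridian and along the parallel, of a surface whose
  profile curve has unit speed.  The lemma \<open>rot_surface_weingarten\<close> below checks them
  against the Weingarten equations for the unit normal pointing towards the axis.
\<close>

definition meridian_curvature :: "(real \<Rightarrow> real) \<Rightarrow> real \<Rightarrow> real" where
  "meridian_curvature f s = - deriv (deriv f) s / sqrt (1 - (deriv f s)\<^sup>2)"

definition parallel_curvature :: "(real \<Rightarrow> real) \<Rightarrow> real \<Rightarrow> real" where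
  "parallel_curvature f s = sqrt (1 - (deriv f s)\<^sup>2) / f s"

text \<open>On vectors, \<open>sgn\<close> is normalization; the scalar factor fixes the orientation.\<close>

definition rot_normal :: "(real \<Rightarrow> real) \<Rightarrow> (real \<Rightarrow> real) \<Rightarrow> real \<Rightarrow> real \<Rightarrow> real^3" where
  "rot_normal f g s \<theta> = sgn (deriv g s) *\<^sub>R
     sgn (cross3 (vector_derivative (\<lambda>u. rot_surface f g u \<theta>) (at s))
                 (vector_derivative (rot_surface f g s) (at \<theta>)))"

lemma has_vector_derivative_vector3:
  assumes "(x has_real_derivative x') (at t)" "(y has_real_derivative y') (at t)"
    "(z has_real_derivative z') (at t)"
  shows "((\<lambda>t. vector [x t, y t, z t] :: real^3) has_vector_derivative vector [x', y', z']) (at t)"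
proof -
  have eq: "(vector [a, b, c] :: real^3) = a *\<^sub>R axis 1 1 + b *\<^sub>R axis 2 1 + c *\<^sub>R axis 3 1"
    for a b c
    by (simp add: vec_eq_iff forall_3 axis_def)
  show ?thesis
    unfolding eq using assms
    by (auto intro!: derivative_eq_intros)
qed

lemma rot_surface_partial_derivatives:
  assumes "(f has_real_derivative f') (at s)" "(g has_real_derivative g') (at s)"
  shows "((\<lambda>u. rot_surface f g u \<theta>) has_vector_derivative
            vector [f' * cos \<theta>, f' * sin \<theta>, g']) (at s)"
    and "(rot_surface f g s has_vector_derivative
            vector [- f s * sin \<theta>, f s * cos \<theta>, 0]) (at \<theta>)"
  unfolding rot_surface_def
  by (rule has_vector_derivative_vector3; use assms in \<open>auto intro!: derivative_eq_intros\<close>)+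

lemma rot_normal_eq:
  assumes "f field_differentiable (at s)" "g field_differentiable (at s)" "f s > 0"
    and "(deriv f s)\<^sup>2 < 1" "(deriv f s)\<^sup>2 + (deriv g s)\<^sup>2 = 1"
  shows "rot_normal f g s \<theta> =
    vector [- sqrt (1 - (deriv f s)\<^sup>2) * cos \<theta>, - sqrt (1 - (deriv f s)\<^sup>2) * sin \<theta>,
            sgn (deriv g s) * deriv f s]"
proof -
  define p q where "p = deriv f s" and "q = deriv g s"
  have d: "(f has_real_derivative p) (at s)" "(g has_real_derivative q) (at s)"
    using assms by (simp_all add: p_def q_def DERIV_deriv_iff_field_differentiable)
  have q: "sqrt (1 - p\<^sup>2) = \<bar>q\<bar>" and pq: "p\<^sup>2 + q\<^sup>2 = 1"
    using assms(5) by (simp_all add: p_def q_def algebra_simps flip: real_sqrt_abs)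
  have sc: "sin \<theta> * sin \<theta> = 1 - cos \<theta> * cos \<theta>"
    using sin_squared_eq[of \<theta>] by (simp add: power2_eq_square)
  have c: "cross3 (vector [p * cos \<theta>, p * sin \<theta>, q]) (vector [- f s * sin \<theta>, f s * cos \<theta>, 0])
      = f s *\<^sub>R vector [- q * cos \<theta>, - q * sin \<theta>, p]"
  proof -
    have "p * cos \<theta> * (f s * cos \<theta>) + p * sin \<theta> * (f s * sin \<theta>) = f s * p"
      using sc by algebra
    then show ?thesis
      by (simp add: cross3_def vec_eq_iff forall_3)
  qed
  have "(- q * cos \<theta>)\<^sup>2 + (- q * sin \<theta>)\<^sup>2 + p\<^sup>2 = q\<^sup>2 * ((cos \<theta>)\<^sup>2 + (sin \<theta>)\<^sup>2) + p\<^sup>2"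
    by algebra
  then have n: "norm (vector [- q * cos \<theta>, - q * sin \<theta>, p] :: real^3) = 1"
    using pq by (simp add: norm_eq_1 inner_vec_def sum_3 power2_eq_square)
  have "rot_normal f g s \<theta> = sgn q *\<^sub>R vector [- q * cos \<theta>, - q * sin \<theta>, p]"
    unfolding rot_normal_def
      rot_surface_partial_derivatives(1)[OF d, THEN vector_derivative_at]
      rot_surface_partial_derivatives(2)[OF d, THEN vector_derivative_at] c
    using n assms(3) by (simp add: sgn_scaleR sgn_div_norm q_def)
  then show ?thesis
    using q by (simp add: vec_eq_iff forall_3 p_def q_def abs_sgn)
qed

lemma rot_surface_weingarten:
  assumes "open I" "smooth_on I f" "smooth_on I g"
    and "\<And>u. u \<in> I \<Longrightarrow> f u > 0"
    and "\<And>u. u \<in> I \<Longrightarrow> (deriv f u)\<^sup>2 < 1"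
    and "\<And>u. u \<in> I \<Longrightarrow> (deriv f u)\<^sup>2 + (deriv g u)\<^sup>2 = 1"
    and s: "s \<in> I"
  shows "((\<lambda>u. rot_normal f g u \<theta>) has_vector_derivative
           - meridian_curvature f s *\<^sub>R vector_derivative (\<lambda>u. rot_surface f g u \<theta>) (at s)) (at s)"
    and "(rot_normal f g s has_vector_derivative
           - parallel_curvature f s *\<^sub>R vector_derivative (rot_surface f g s) (at \<theta>)) (at \<theta>)"
proof -
  have D: "((deriv ^^ n) f) field_differentiable (at u)" "((deriv ^^ n) g) field_differentiable (at u)"
    if "u \<in> I" for u n
    using assms(2,3) that by (auto simp: smooth_on_def)
  have D0: "f field_differentiable (at u)" "g field_differentiable (at u)" if "u \<in> I" for u
    using D[OF that, of 0] by simp_all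
  have D1: "deriv f field_differentiable (at u)" "deriv g field_differentiable (at u)" if "u \<in> I" for u
    using D[OF that, of 1] by simp_all
  define p r q where "p = deriv f s" and "r = deriv (deriv f) s" and "q = deriv g s"
  have d: "(f has_real_derivative p) (at s)" "(g has_real_derivative q) (at s)"
    "(deriv f has_real_derivative r) (at s)"
    using D0[OF s] D1[OF s] by (simp_all add: p_def q_def r_def DERIV_deriv_iff_field_differentiable)
  have N: "rot_normal f g u \<phi> = vector [- sqrt (1 - (deriv f u)\<^sup>2) * cos \<phi>,
      - sqrt (1 - (deriv f u)\<^sup>2) * sin \<phi>, sgn (deriv g u) * deriv f u]" if "u \<in> I" for u \<phi>
    using rot_normal_eq D0 assms(4-6) that by blast
  have fs: "f s > 0" and p1: "p\<^sup>2 < 1" and pq: "p\<^sup>2 + q\<^sup>2 = 1"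
    using assms(4-6) s by (auto simp: p_def q_def)
  then have q0: "q \<noteq> 0" and sq: "sqrt (1 - p\<^sup>2) = \<bar>q\<bar>" and sq0: "sqrt (1 - p\<^sup>2) > 0"
    by (auto simp: algebra_simps simp flip: real_sqrt_abs)
  have cont: "(deriv g \<longlongrightarrow> q) (nhds s)"
    using field_differentiable_imp_continuous_at[OF D1(2)[OF s]]
    by (simp add: q_def isCont_def tendsto_at_iff_tendsto_nhds)
  have "eventually (\<lambda>u. sgn (deriv g u) = sgn q) (nhds s)"
  proof (cases "q > 0")
    case True
    then show ?thesis
      using order_tendstoD(1)[OF cont True] by (auto elim!: eventually_mono)
  next
    case False
    then have "q < 0" using q0 by simp
    then show ?thesis
      using order_tendstoD(2)[OF cont \<open>q < 0\<close>] by (auto elim!: eventually_mono)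
  qed
  moreover have "eventually (\<lambda>u. u \<in> I) (nhds s)"
    using assms(1) s eventually_nhds by blast
  ultimately have ev: "eventually (\<lambda>u. rot_normal f g u \<theta> = vector [- sqrt (1 - (deriv f u)\<^sup>2) * cos \<theta>,
      - sqrt (1 - (deriv f u)\<^sup>2) * sin \<theta>, sgn q * deriv f u]) (nhds s)"
    by eventually_elim (simp add: N)
  have k: "meridian_curvature f s = - r / \<bar>q\<bar>" "parallel_curvature f s = \<bar>q\<bar> / f s"
    by (simp_all add: meridian_curvature_def parallel_curvature_def sq flip: p_def r_def)
  have ds: "((\<lambda>u. sqrt (1 - (deriv f u)\<^sup>2)) has_real_derivative - p * r / \<bar>q\<bar>) (at s)"
    using sq0 p1 by (auto intro!: derivative_eq_intros d simp: sq p_def[symmetric] field_simps)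
  have "((\<lambda>u. vector [- sqrt (1 - (deriv f u)\<^sup>2) * cos \<theta>, - sqrt (1 - (deriv f u)\<^sup>2) * sin \<theta>,
            sgn q * deriv f u] :: real^3) has_vector_derivative
          vector [(p * r / \<bar>q\<bar>) * cos \<theta>, (p * r / \<bar>q\<bar>) * sin \<theta>, sgn q * r]) (at s)"
    by (rule has_vector_derivative_vector3; (rule derivative_eq_intros ds d refl | simp)+)
  moreover have "vector [(p * r / \<bar>q\<bar>) * cos \<theta>, (p * r / \<bar>q\<bar>) * sin \<theta>, sgn q * r] =
      - meridian_curvature f s *\<^sub>R vector_derivative (\<lambda>u. rot_surface f g u \<theta>) (at s)"
    unfolding k rot_surface_partial_derivatives(1)[OF d(1,2), THEN vector_derivative_at]
    using q0 by (simp add: vec_eq_iff forall_3 sgn_if)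
  moreover obtain S where "open S" "s \<in> S"
    "\<And>u. u \<in> S \<Longrightarrow> vector [- sqrt (1 - (deriv f u)\<^sup>2) * cos \<theta>,
      - sqrt (1 - (deriv f u)\<^sup>2) * sin \<theta>, sgn q * deriv f u] = rot_normal f g u \<theta>"
    using ev by (auto simp: eventually_nhds)
  ultimately show "((\<lambda>u. rot_normal f g u \<theta>) has_vector_derivative
      - meridian_curvature f s *\<^sub>R vector_derivative (\<lambda>u. rot_surface f g u \<theta>) (at s)) (at s)"
    using has_vector_derivative_transform_within_open by fastforce
  have "(rot_normal f g s has_vector_derivative
      vector [\<bar>q\<bar> * sin \<theta>, - \<bar>q\<bar> * cos \<theta>, 0]) (at \<theta>)"
    unfolding N[OF s] sq p_def[symmetric]
    by (rule has_vector_derivative_vector3; (rule derivative_eq_intros refl | simp)+)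
  moreover have "vector [\<bar>q\<bar> * sin \<theta>, - \<bar>q\<bar> * cos \<theta>, 0] =
      - parallel_curvature f s *\<^sub>R vector_derivative (rot_surface f g s) (at \<theta>)"
    unfolding k rot_surface_partial_derivatives(2)[OF d(1,2), THEN vector_derivative_at]
    using fs by (simp add: vec_eq_iff forall_3)
  ultimately show "(rot_normal f g s has_vector_derivative
      - parallel_curvature f s *\<^sub>R vector_derivative (rot_surface f g s) (at \<theta>)) (at \<theta>)"
    by simp
qed


subsection \<open>Loxodromes\<close>

definition lox_s :: "real \<Rightarrow> real \<Rightarrow> real \<Rightarrow> real" where
  "lox_s \<psi> c t = cos \<psi> * t + c"

text \<open>The interval integral is oriented, so it is the right one for \<open>t < t0\<close> as well.\<close>

definition lox_theta ::
    "(real \<Rightarrow> real) \<Rightarrow> real \<Rightarrow> real \<Rightarrow> real \<Rightarrow> real \<Rightarrow> real \<Rightarrow> real" where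
  "lox_theta f \<psi> \<epsilon> c t0 t = \<epsilon> * sin \<psi> * (LBINT \<xi>=t0..t. 1 / f (lox_s \<psi> c \<xi>))"

definition loxodrome ::
    "(real \<Rightarrow> real) \<Rightarrow> (real \<Rightarrow> real) \<Rightarrow> real \<Rightarrow> real \<Rightarrow> real \<Rightarrow> real \<Rightarrow> real \<Rightarrow> real^3" where
  "loxodrome f g \<psi> \<epsilon> c t0 t = rot_surface f g (lox_s \<psi> c t) (lox_theta f \<psi> \<epsilon> c t0 t)"

end

theory Submission
  imports Defs
begin

text \<open>
  Write \<open>p = f'\<close> and \<open>q = g'\<close>. The curvature condition is the ODE
  \<open>p' = - k q\<^sup>2 / f\<close>, and differentiating \<open>p\<^sup>2 + q\<^sup>2 = 1\<close> turns it into \<open>q' = k p q / f\<close>.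
  Hence \<open>q f\<^bsup>-k\<^esup>\<close> is a nonzero constant on the interval: its absolute value is \<open>d\<close> and its sign
  is the \<open>\<plusminus>\<close> of the torsion. In the cylindrical frame rotating with \<open>\<theta>\<close>, the first three
  derivatives of the unit-speed curve \<open>\<alpha>\<close> then have coordinates that are polynomials in
  \<open>a, b, k, p, q\<close> divided by powers of \<open>f\<close>, and both formulas reduce to polynomial identities modulo
  \<open>a\<^sup>2 + b\<^sup>2 = 1\<close> and \<open>p\<^sup>2 + q\<^sup>2 = 1\<close>.
\<close>

section \<open>Differentiation of integrals and iterated vector derivatives\<close>

text \<open>\<open>interval_integral_FTC2\<close> gives a derivative within a compact interval. As
  \<open>J\<close> is an open interval, some \<open>{l..r}\<close> inside \<open>J\<close> has both
  \<open>c\<close> and \<open>t\<close> in its interior, so the derivative at \<open>t\<close> is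
  two-sided, for \<open>t < c\<close> as well.\<close>

lemma has_real_derivative_interval_integral:
  fixes h :: "real \<Rightarrow> real"
  assumes "open J" "is_interval J" "continuous_on J h" "c \<in> J" "t \<in> J"
  shows "((\<lambda>u. LBINT x=c..u. h x) has_real_derivative h t) (at t)"
proof -
  have "min c t \<in> J" "max c t \<in> J"
    using assms(4,5) by (auto simp: min_def max_def)
  then obtain e1 e2 where e: "e1 > 0" "cball (min c t) e1 \<subseteq> J" "e2 > 0" "cball (max c t) e2 \<subseteq> J"
    using assms(1) open_contains_cball by metis
  define l r where "l = min c t - e1" and "r = max c t + e2"
  have "l \<in> cball (min c t) e1" "r \<in> cball (max c t) e2"
    using e(1,3) by (simp_all add: l_def r_def dist_real_def)
  then have "l \<in> J" "r \<in> J"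
    using e(2,4) by blast+
  then have "{l..r} \<subseteq> J"
    using assms(2) unfolding is_interval_1 by (meson atLeastAtMost_iff subsetI)
  then have "continuous_on {l..r} h"
    using assms(3) continuous_on_subset by blast
  moreover have lr: "l < c" "c < r" "l < t" "t < r"
    using e(1,3) by (auto simp: l_def r_def)
  ultimately have "((\<lambda>u. LBINT x=c..u. h x) has_vector_derivative h t) (at t within {l..r})"
    by (intro interval_integral_FTC2) auto
  then show ?thesis
    using lr by (simp add: at_within_Icc_at has_real_derivative_iff_has_vector_derivative)
qed

text \<open>Reads iterated derivatives off a chain of candidates. A derivative at \<open>t\<close>
  depends on the function near \<open>t\<close>, so the induction carries the equality on the whole
  open set \<open>J\<close>.\<close>

lemma curve_deriv_eqI:
  assumes "open J" "t \<in> J" "n \<le> N"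
    and "\<And>i u. i < N \<Longrightarrow> u \<in> J \<Longrightarrow> (\<beta> i has_vector_derivative \<beta> (Suc i) u) (at u)"
  shows "curve_deriv n (\<beta> 0) t = \<beta> n t"
  using assms(2,3)
proof (induction n arbitrary: t)
  case 0
  then show ?case by (simp add: curve_deriv_def)
next
  case (Suc n)
  have "(\<beta> n has_vector_derivative \<beta> (Suc n) t) (at t)"
    using assms(4) Suc.prems by simp
  then have "(curve_deriv n (\<beta> 0) has_vector_derivative \<beta> (Suc n) t) (at t)"
    by (rule has_vector_derivative_transform_within_open[OF _ assms(1)]) (use Suc in auto)
  then show ?case
    by (simp add: curve_deriv_def vector_derivative_at)
qed


subsection \<open>Cylindrical frames\<close>

text \<open>The rotation about the third axis through the angle \<theta>, applied to
  \<open>(x, y, z)\<close>: radial, tangential and axial components. Rotations preserve inner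
  products and determinants, so \<theta> drops out of every quantity computed from these
  components.\<close>

definition cyl :: "real \<Rightarrow> real \<Rightarrow> real \<Rightarrow> real \<Rightarrow> real^3" where
  "cyl \<theta> x y z = vector [x * cos \<theta> - y * sin \<theta>, x * sin \<theta> + y * cos \<theta>, z]"

text \<open>The frame turns with angular velocity \<omega>: the radial unit vector has derivative
  \<omega> times the tangential one, and the tangential one has derivative -\<omega> times the
  radial one. This accounts for the two cross terms.\<close>

lemma has_vector_derivative_cyl:
  assumes "(\<theta> has_real_derivative \<omega>) (at t)" "(x has_real_derivative x') (at t)"
    "(y has_real_derivative y') (at t)" "(z has_real_derivative z') (at t)"
  shows "((\<lambda>t. cyl (\<theta> t) (x t) (y t) (z t)) has_vector_derivative
           cyl (\<theta> t) (x' - \<omega> * y t) (y' + \<omega> * x t) z') (at t)"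
proof -
  have x: "((\<lambda>t. x t * cos (\<theta> t) - y t * sin (\<theta> t)) has_real_derivative
      (x' - \<omega> * y t) * cos (\<theta> t) - (y' + \<omega> * x t) * sin (\<theta> t)) (at t)"
    by (rule derivative_eq_intros assms refl)+ (simp add: algebra_simps)
  have y: "((\<lambda>t. x t * sin (\<theta> t) + y t * cos (\<theta> t)) has_real_derivative
      (x' - \<omega> * y t) * sin (\<theta> t) + (y' + \<omega> * x t) * cos (\<theta> t)) (at t)"
    by (rule derivative_eq_intros assms refl)+ (simp add: algebra_simps)
  show ?thesis
    unfolding cyl_def by (rule has_vector_derivative_vector3[OF x y assms(4)])
qed

lemma inner_cyl: "cyl \<theta> x y z \<bullet> cyl \<theta> x' y' z' = x * x' + y * y' + z * z'"
proof -
  have "(sin \<theta>)\<^sup>2 + (cos \<theta>)\<^sup>2 = 1" by simp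
  then show ?thesis
    unfolding cyl_def inner_vec_def sum_3 vector_3 inner_real_def by algebra
qed

lemma norm_cyl_squared: "(norm (cyl \<theta> x y z))\<^sup>2 = x\<^sup>2 + y\<^sup>2 + z\<^sup>2"
  unfolding power2_norm_eq_inner inner_cyl by (simp add: power2_eq_square)

lemma det_cyl:
  "det (vector [cyl \<theta> x y z, cyl \<theta> x' y' z', cyl \<theta> x'' y'' z''] :: real^3^3)
    = x * (y' * z'' - z' * y'') - y * (x' * z'' - z' * x'') + z * (x' * y'' - y' * x'')"
proof -
  have "(sin \<theta>)\<^sup>2 + (cos \<theta>)\<^sup>2 = 1" by simp
  then show ?thesis
    unfolding det_3 cyl_def vector_3 by algebra
qed


subsection \<open>The profile curve\<close>

text \<open>The square root in both principal curvatures equals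
  \<open>\<bar>deriv g u\<bar>\<close>, and clearing denominators squares it, so the equation for
  \<open>f''\<close> holds for either sign of \<open>g'\<close>. The strict bound on
  \<open>f'\<close> makes \<open>g'\<close> nonzero, which permits the cancellation that isolates
  \<open>g''\<close>.\<close>

lemma rot_surface_profile_ode:
  assumes "open I" "smooth_on I f" "smooth_on I g"
    and "\<And>u. u \<in> I \<Longrightarrow> f u > 0"
    and p1: "\<And>u. u \<in> I \<Longrightarrow> (deriv f u)\<^sup>2 < 1"
    and pq: "\<And>u. u \<in> I \<Longrightarrow> (deriv f u)\<^sup>2 + (deriv g u)\<^sup>2 = 1"
    and mp: "\<And>u. u \<in> I \<Longrightarrow> meridian_curvature f u = k * parallel_curvature f u"
    and "u \<in> I"
  shows "(f has_real_derivative deriv f u) (at u)"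
    and "(g has_real_derivative deriv g u) (at u)"
    and "(deriv f has_real_derivative - k * (deriv g u)\<^sup>2 / f u) (at u)"
    and "(deriv g has_real_derivative k * deriv f u * deriv g u / f u) (at u)"
proof -
  have D: "((deriv ^^ n) f) field_differentiable (at u)" "((deriv ^^ n) g) field_differentiable (at u)"
    for n
    using assms(2,3,8) by (auto simp: smooth_on_def)
  show "(f has_real_derivative deriv f u) (at u)" "(g has_real_derivative deriv g u) (at u)"
    using D[of 0] by (simp_all add: DERIV_deriv_iff_field_differentiable)
  have D1: "(deriv f has_real_derivative deriv (deriv f) u) (at u)"
    "(deriv g has_real_derivative deriv (deriv g) u) (at u)"
    using D[of 1] by (simp_all add: DERIV_deriv_iff_field_differentiable)
  have fu: "f u > 0" and q0: "deriv g u \<noteq> 0" and w: "sqrt (1 - (deriv f u)\<^sup>2) = \<bar>deriv g u\<bar>"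
    using assms(4) p1 pq assms(8) by (auto simp: algebra_simps simp flip: real_sqrt_abs)
      (metis power_zero_numeral add.right_neutral less_irrefl)+
  have "- deriv (deriv f) u / \<bar>deriv g u\<bar> = k * (\<bar>deriv g u\<bar> / f u)"
    using mp[OF assms(8)] by (simp add: meridian_curvature_def parallel_curvature_def w)
  then have "deriv (deriv f) u = - k * (\<bar>deriv g u\<bar>)\<^sup>2 / f u"
    using q0 fu by (simp add: field_simps power2_eq_square del: power2_abs)
  then have f2: "deriv (deriv f) u = - k * (deriv g u)\<^sup>2 / f u"
    by simp
  then show "(deriv f has_real_derivative - k * (deriv g u)\<^sup>2 / f u) (at u)"
    using D1(1) by simp
  have "((\<lambda>v. (deriv f v)\<^sup>2 + (deriv g v)\<^sup>2) has_real_derivative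
      2 * deriv f u * deriv (deriv f) u + 2 * deriv g u * deriv (deriv g) u) (at u)"
    by (rule derivative_eq_intros D1 refl)+ simp
  moreover have "((\<lambda>v. (deriv f v)\<^sup>2 + (deriv g v)\<^sup>2) has_real_derivative 0) (at u)"
    by (rule has_field_derivative_transform_within_open[OF DERIV_const assms(1,8)]) (simp add: pq)
  ultimately have "2 * deriv f u * deriv (deriv f) u + 2 * deriv g u * deriv (deriv g) u = 0"
    by (rule DERIV_unique)
  then have "deriv g u * deriv (deriv g) u = - deriv f u * deriv (deriv f) u"
    by simp
  then have "deriv g u * deriv (deriv g) u = deriv g u * (k * deriv f u * deriv g u / f u)"
    by (simp add: f2 power2_eq_square)
  then have "deriv (deriv g) u = k * deriv f u * deriv g u / f u"
    using q0 mult_left_cancel by blast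
  then show "(deriv g has_real_derivative k * deriv f u * deriv g u / f u) (at u)"
    using D1(2) by simp
qed

text \<open>The product of \<open>q\<close> with \<open>f powr (- k)\<close> has zero derivative,
  because the logarithmic derivative of \<open>f powr k\<close> is \<open>k * f' / f\<close>.
  Connectedness of \<open>I\<close> then gives a single constant \<open>D\<close>, whose sign is
  left open.\<close>

lemma powr_proportional_of_ode:
  fixes f q :: "real \<Rightarrow> real"
  assumes "open I" "connected I"
    and "\<And>u. u \<in> I \<Longrightarrow> f u > 0"
    and "\<And>u. u \<in> I \<Longrightarrow> (f has_real_derivative f' u) (at u)"
    and "\<And>u. u \<in> I \<Longrightarrow> (q has_real_derivative k * f' u * q u / f u) (at u)"
  obtains D where "\<And>u. u \<in> I \<Longrightarrow> q u = D * f u powr k"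
proof -
  have "((\<lambda>v. q v * f v powr (- k)) has_real_derivative 0) (at u)" if "u \<in> I" for u
    using assms(3)[OF that]
    by (auto intro!: derivative_eq_intros assms(4,5) that simp: powr_diff field_simps)
  \<comment> \<open>\<open>DERIV_zero_connected_constant\<close> admits a finite exceptional set,
    here taken to be empty.\<close>
  then obtain D where D: "\<And>u. u \<in> I \<Longrightarrow> q u * f u powr (- k) = D"
    using DERIV_zero_connected_constant[OF assms(2,1) finite.emptyI]
    by (metis (no_types, lifting) DERIV_isCont Diff_empty continuous_at_imp_continuous_on)
  have "q u = D * f u powr k" if "u \<in> I" for u
    using D[OF that] assms(3)[OF that] by (auto simp: powr_minus field_simps)
  then show ?thesis by (rule that)
qed


subsection \<open>Curvature and torsion of a loxodrome\<close>

text \<open>In the rotating frame the curve has components \<open>(f, 0, g)\<close>, with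
  \<open>s' = a\<close> and \<open>\<theta>' = b / f\<close>. The equations for \<open>p\<close> and
  \<open>q\<close> remove each new derivative, so all components stay rational in \<open>p\<close>,
  \<open>q\<close> and \<open>f\<close>. The relation between \<open>P\<^sup>2\<close> and
  \<open>Q\<^sup>2\<close> is not yet applied, so both occur in the third derivative.\<close>

lemma loxodrome_curve_deriv:
  fixes f g p q :: "real \<Rightarrow> real" and I :: "real set" and k \<psi> \<epsilon> c t0 a b :: real
  assumes "open I" "is_interval I"
    and f0: "\<And>u. u \<in> I \<Longrightarrow> f u > 0"
    and f: "\<And>u. u \<in> I \<Longrightarrow> (f has_real_derivative p u) (at u)"
    and g: "\<And>u. u \<in> I \<Longrightarrow> (g has_real_derivative q u) (at u)"
    and p: "\<And>u. u \<in> I \<Longrightarrow> (p has_real_derivative - k * (q u)\<^sup>2 / f u) (at u)"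
    and q: "\<And>u. u \<in> I \<Longrightarrow> (q has_real_derivative k * p u * q u / f u) (at u)"
    and "lox_s \<psi> c t0 \<in> I" "lox_s \<psi> c t \<in> I"
    and a: "a = cos \<psi>" and b: "b = \<epsilon> * sin \<psi>"
  defines "\<alpha> \<equiv> loxodrome f g \<psi> \<epsilon> c t0" and "\<theta> \<equiv> lox_theta f \<psi> \<epsilon> c t0 t"
    and "F \<equiv> f (lox_s \<psi> c t)" and "P \<equiv> p (lox_s \<psi> c t)" and "Q \<equiv> q (lox_s \<psi> c t)"
  shows "curve_deriv 1 \<alpha> t = cyl \<theta> (a * P) b (a * Q)"
    and "curve_deriv 2 \<alpha> t = cyl \<theta> (- (k * a\<^sup>2 * Q\<^sup>2 + b\<^sup>2) / F) (a * b * P / F) (k * a\<^sup>2 * P * Q / F)"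
    and "curve_deriv 3 \<alpha> t = cyl \<theta>
      (a * P * (k * a\<^sup>2 * Q\<^sup>2 - 2 * k\<^sup>2 * a\<^sup>2 * Q\<^sup>2) / F\<^sup>2)
      (- b * (a\<^sup>2 * P\<^sup>2 + 2 * k * a\<^sup>2 * Q\<^sup>2 + b\<^sup>2) / F\<^sup>2)
      (k * a^3 * Q * (k * P\<^sup>2 - P\<^sup>2 - k * Q\<^sup>2) / F\<^sup>2)"
proof -
  define s where "s = lox_s \<psi> c"
  define \<Theta> where "\<Theta> = lox_theta f \<psi> \<epsilon> c t0"
  define J where "J = s -` I"
  have ds: "(s has_real_derivative a) (at u)" for u
    unfolding s_def lox_s_def[abs_def] a by (auto intro!: derivative_eq_intros)
  have J: "open J" "t0 \<in> J" "t \<in> J"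
    using assms(8,9) DERIV_isCont[OF ds]
    by (auto simp: J_def s_def intro!: open_vimage assms(1) continuous_at_imp_continuous_on)
  \<comment> \<open>The map \<open>s\<close> is affine, hence nondecreasing or decreasing according
    to the sign of \<open>cos \<psi>\<close>. The case \<open>cos \<psi> = 0\<close>, where
    \<open>s\<close> is constant, belongs to the first branch.\<close>
  have "is_interval J"
    unfolding is_interval_1
  proof (intro ballI allI impI)
    fix u v x assume uv: "u \<in> J" "v \<in> J" and x: "u \<le> x \<and> x \<le> v"
    show "x \<in> J"
    proof (cases "0 \<le> cos \<psi>")
      case True
      then have "s u \<le> s x \<and> s x \<le> s v"
        using x by (auto simp: s_def lox_s_def intro!: mult_left_mono)
      with uv assms(2) show ?thesis
        unfolding J_def is_interval_1 by blast
    next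
      case False
      then have "s v \<le> s x \<and> s x \<le> s u"
        using x by (auto simp: s_def lox_s_def intro!: mult_left_mono_neg)
      with uv assms(2) show ?thesis
        unfolding J_def is_interval_1 by blast
    qed
  qed
  have f': "((\<lambda>u. f (s u)) has_real_derivative p (s u) * a) (at u)"
    and g': "((\<lambda>u. g (s u)) has_real_derivative q (s u) * a) (at u)"
    and p': "((\<lambda>u. p (s u)) has_real_derivative - k * (q (s u))\<^sup>2 / f (s u) * a) (at u)"
    and q': "((\<lambda>u. q (s u)) has_real_derivative k * p (s u) * q (s u) / f (s u) * a) (at u)"
    and fs: "f (s u) > 0" if "u \<in> J" for u
    using DERIV_chain2[OF f ds] DERIV_chain2[OF g ds] DERIV_chain2[OF p ds] DERIV_chain2[OF q ds]
      f0 that by (simp_all add: J_def)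
  have "continuous_on J (\<lambda>u. 1 / f (s u))"
    using fs by (intro continuous_at_imp_continuous_on ballI isCont_divide continuous_const
      DERIV_isCont[OF f']) fastforce+
  then have "((\<lambda>u. LBINT x=t0..u. 1 / f (s x)) has_real_derivative 1 / f (s u)) (at u)"
    if "u \<in> J" for u
    using has_real_derivative_interval_integral J \<open>is_interval J\<close> that by blast
  then have \<Theta>': "(\<Theta> has_real_derivative b / f (s u)) (at u)" if "u \<in> J" for u
    using DERIV_cmult[of _ "1 / f (s u)" u UNIV b] that
    by (simp add: \<Theta>_def lox_theta_def[abs_def] b s_def)
  define X where "X u = - (k * a\<^sup>2 * (q (s u))\<^sup>2 + b\<^sup>2) / f (s u)" for u
  define Y where "Y u = a * b * p (s u) / f (s u)" for u
  define Z where "Z u = k * a\<^sup>2 * p (s u) * q (s u) / f (s u)" for u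
  \<comment> \<open>The primed functions are the frame components of the third derivative of
    \<alpha>, not the derivatives of \<open>X\<close>, \<open>Y\<close>, \<open>Z\<close>: the cross
    terms from the rotation of the frame are already included in \<open>X'\<close> and
    \<open>Y'\<close>.\<close>
  define X' where "X' u = a * p (s u) * (k * a\<^sup>2 * (q (s u))\<^sup>2 - 2 * k\<^sup>2 * a\<^sup>2 * (q (s u))\<^sup>2) / (f (s u))\<^sup>2" for u
  define Y' where "Y' u = - b * (a\<^sup>2 * (p (s u))\<^sup>2 + 2 * k * a\<^sup>2 * (q (s u))\<^sup>2 + b\<^sup>2) / (f (s u))\<^sup>2" for u
  define Z' where "Z' u = k * a^3 * q (s u) * (k * (p (s u))\<^sup>2 - (p (s u))\<^sup>2 - k * (q (s u))\<^sup>2) / (f (s u))\<^sup>2" for u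
  define \<beta> where "\<beta> n =
    [\<alpha>, \<lambda>u. cyl (\<Theta> u) (a * p (s u)) b (a * q (s u)), \<lambda>u. cyl (\<Theta> u) (X u) (Y u) (Z u),
     \<lambda>u. cyl (\<Theta> u) (X' u) (Y' u) (Z' u)] ! n" for n
  have 0: "(\<alpha> has_vector_derivative cyl (\<Theta> u) (a * p (s u)) b (a * q (s u))) (at u)" if "u \<in> J" for u
  proof -
    \<comment> \<open>The position has tangential component 0; the rotation contributes
      \<open>(b / f) * f = b\<close>, which is why the tangential component of the velocity is
      constant.\<close>
    have "\<alpha> = (\<lambda>u. cyl (\<Theta> u) (f (s u)) 0 (g (s u)))"
      by (simp add: \<alpha>_def loxodrome_def[abs_def] rot_surface_def cyl_def s_def \<Theta>_def)
    then show ?thesis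
      using has_vector_derivative_cyl[OF \<Theta>' f' DERIV_const g', OF that that that, of 0] fs[OF that]
      by (simp add: mult.commute)
  qed
  have 1: "((\<lambda>u. cyl (\<Theta> u) (a * p (s u)) b (a * q (s u))) has_vector_derivative
      cyl (\<Theta> u) (X u) (Y u) (Z u)) (at u)" if "u \<in> J" for u
    using has_vector_derivative_cyl[OF \<Theta>' DERIV_cmult[OF p'] DERIV_const DERIV_cmult[OF q'],
        OF that that that, of a b a] fs[OF that]
    by (elim has_vector_derivative_eq_rhs)
      (rule arg_cong4, auto simp: X_def Y_def Z_def field_simps power2_eq_square)
  have 2: "((\<lambda>u. cyl (\<Theta> u) (X u) (Y u) (Z u)) has_vector_derivative
      cyl (\<Theta> u) (X' u) (Y' u) (Z' u)) (at u)" if "u \<in> J" for u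
  proof -
    have ne: "f (s u) \<noteq> 0" using fs[OF that] by simp
    note D = derivative_eq_intros f'[OF that] p'[OF that] q'[OF that] ne refl
    have "(X has_real_derivative X' u + b / f (s u) * Y u) (at u)"
      unfolding X_def[abs_def] by (rule D)+
        (use ne in \<open>simp add: X'_def Y_def field_simps; algebra\<close>)
    moreover have "(Y has_real_derivative Y' u - b / f (s u) * X u) (at u)"
      unfolding Y_def[abs_def] by (rule D)+
        (use ne in \<open>simp add: Y'_def X_def field_simps; algebra\<close>)
    moreover have "(Z has_real_derivative Z' u) (at u)"
      unfolding Z_def[abs_def] by (rule D)+
        (use ne in \<open>simp add: Z'_def field_simps; algebra\<close>)
    ultimately show ?thesis
      using has_vector_derivative_cyl[OF \<Theta>'[OF that]] by fastforce
  qed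
  have \<beta>: "(\<beta> i has_vector_derivative \<beta> (Suc i) u) (at u)" if "i < 3" "u \<in> J" for i u
  proof -
    have "i = 0 \<or> i = 1 \<or> i = 2" using that(1) by auto
    then show ?thesis
      using 0 1 2 that(2) by (auto simp: \<beta>_def numeral_2_eq_2)
  qed
  have "curve_deriv n \<alpha> t = \<beta> n t" if "n \<le> 3" for n
    using curve_deriv_eqI[where \<beta> = \<beta>, OF J(1,3) that \<beta>] by (simp add: \<beta>_def)
  from this[of 1] this[of 2] this[of 3] show "curve_deriv 1 \<alpha> t = cyl \<theta> (a * P) b (a * Q)"
    and "curve_deriv 2 \<alpha> t = cyl \<theta> (- (k * a\<^sup>2 * Q\<^sup>2 + b\<^sup>2) / F) (a * b * P / F) (k * a\<^sup>2 * P * Q / F)"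
    and "curve_deriv 3 \<alpha> t = cyl \<theta>
      (a * P * (k * a\<^sup>2 * Q\<^sup>2 - 2 * k\<^sup>2 * a\<^sup>2 * Q\<^sup>2) / F\<^sup>2)
      (- b * (a\<^sup>2 * P\<^sup>2 + 2 * k * a\<^sup>2 * Q\<^sup>2 + b\<^sup>2) / F\<^sup>2)
      (k * a^3 * Q * (k * P\<^sup>2 - P\<^sup>2 - k * Q\<^sup>2) / F\<^sup>2)"
    by (simp_all add: \<beta>_def X_def Y_def Z_def X'_def Y'_def Z'_def \<theta>_def \<Theta>_def F_def P_def Q_def s_def
        numeral_2_eq_2 numeral_3_eq_3)
qed

text \<open>By Lagrange's identity, the cross product of a unit vector with an orthogonal vector has
  the norm of the latter. So the denominator of the torsion is the squared curvature.\<close>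

lemma curvature_of_unit_speed:
  assumes "norm (curve_deriv 1 \<alpha> t) = 1" "curve_deriv 1 \<alpha> t \<bullet> curve_deriv 2 \<alpha> t = 0"
  shows "curvature \<alpha> t = norm (curve_deriv 2 \<alpha> t)"
    and "torsion \<alpha> t =
      det (vector [curve_deriv 1 \<alpha> t, curve_deriv 2 \<alpha> t, curve_deriv 3 \<alpha> t] :: real^3^3) /
        (curvature \<alpha> t)\<^sup>2"
proof -
  have "norm (cross3 (curve_deriv 1 \<alpha> t) (curve_deriv 2 \<alpha> t)) = norm (curve_deriv 2 \<alpha> t)"
    using norm_cross[of "curve_deriv 1 \<alpha> t" "curve_deriv 2 \<alpha> t"] assms by simp
  then show "curvature \<alpha> t = norm (curve_deriv 2 \<alpha> t)"
    and "torsion \<alpha> t =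
      det (vector [curve_deriv 1 \<alpha> t, curve_deriv 2 \<alpha> t, curve_deriv 3 \<alpha> t] :: real^3^3) /
        (curvature \<alpha> t)\<^sup>2"
    using assms(1) by (simp_all add: curvature_def torsion_def)
qed

section \<open>Polynomial identities for curvature and torsion\<close>

text \<open>The left side is \<open>F\<^sup>2\<close> times the squared norm of the second
  derivative. The right side becomes the radicand of the curvature formula once
  \<open>q\<^sup>2\<close> is replaced by \<open>d\<^sup>2 * F powr (2 * k)\<close>.\<close>

lemma loxodrome_curvature_identity:
  fixes a b k p q :: real
  assumes "a\<^sup>2 + b\<^sup>2 = 1" "p\<^sup>2 + q\<^sup>2 = 1"
  shows "(k * a\<^sup>2 * q\<^sup>2 + b\<^sup>2)\<^sup>2 + (a * b * p)\<^sup>2 + (k * a\<^sup>2 * p * q)\<^sup>2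
    = b\<^sup>2 + a\<^sup>2 * (a\<^sup>2 * k\<^sup>2 + 2 * k * b\<^sup>2 - b\<^sup>2) * q\<^sup>2"
  using assms by algebra

text \<open>The left side is the determinant of the first three derivatives with the powers of
  \<open>F\<close> cleared. On the right \<open>p\<close> is eliminated; the one factor
  \<open>q\<close> outside the bracket carries the sign of the torsion, while the bracket depends
  only on \<open>q\<^sup>2\<close>.\<close>

lemma loxodrome_torsion_identity:
  fixes a b k p q :: real
  assumes "a\<^sup>2 + b\<^sup>2 = 1" "p\<^sup>2 + q\<^sup>2 = 1"
  defines "x \<equiv> - (k * a\<^sup>2 * q\<^sup>2 + b\<^sup>2)" and "y \<equiv> a * b * p" and "z \<equiv> k * a\<^sup>2 * p * q"
    and "x' \<equiv> a * p * (k * a\<^sup>2 * q\<^sup>2 - 2 * k\<^sup>2 * a\<^sup>2 * q\<^sup>2)"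
    and "y' \<equiv> - b * (a\<^sup>2 * p\<^sup>2 + 2 * k * a\<^sup>2 * q\<^sup>2 + b\<^sup>2)"
    and "z' \<equiv> k * a^3 * q * (k * p\<^sup>2 - p\<^sup>2 - k * q\<^sup>2)"
  shows "a * p * (y * z' - z * y') - b * (x * z' - z * x') + a * q * (x * y' - y * x')
    = a * b * q * (b\<^sup>2 + a\<^sup>2 * k\<^sup>2 -
        (a\<^sup>2 * b\<^sup>2 + (a^4 - 2 * a\<^sup>2 * b\<^sup>2 - a\<^sup>2) * k + (2 * a\<^sup>2 - 3 * a^4) * k\<^sup>2 + a^4 * k^3) * q\<^sup>2)"
  unfolding x_def y_def z_def x'_def y'_def z'_def
  using assms(1,2) by algebra

theorem lemma2:
  fixes f g :: "real \<Rightarrow> real" and I :: "real set"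
    and k \<psi> \<epsilon> c t0 a b :: real and \<alpha> :: "real \<Rightarrow> real^3"
  assumes "open I" and "is_interval I"
    and "smooth_on I f" and "smooth_on I g"
    and "\<And>u. u \<in> I \<Longrightarrow> f u > 0"
    and "\<And>u. u \<in> I \<Longrightarrow> (deriv f u)\<^sup>2 < 1"
    and "\<And>u. u \<in> I \<Longrightarrow> (deriv f u)\<^sup>2 + (deriv g u)\<^sup>2 = 1"
    and "k \<noteq> 0"
    and "\<And>u. u \<in> I \<Longrightarrow> meridian_curvature f u = k * parallel_curvature f u"
    and "0 \<le> \<psi>" and "\<psi> \<le> pi" and "\<epsilon> = 1 \<or> \<epsilon> = -1"
    and "lox_s \<psi> c t0 \<in> I"
    and "\<alpha> = loxodrome f g \<psi> \<epsilon> c t0"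
    and "a = cos \<psi>" and "b = \<epsilon> * sin \<psi>"
  shows "\<exists>d>0. \<exists>\<sigma>\<in>{1, -1}. (\<forall>u\<in>I. sgn (deriv g u) = \<sigma>) \<and>
    (\<forall>t. lox_s \<psi> c t \<in> I \<longrightarrow>
      (let F = f (lox_s \<psi> c t); \<kappa> = curvature \<alpha> t; \<tau> = torsion \<alpha> t in
        \<kappa> = sqrt (b\<^sup>2 + d\<^sup>2 * a\<^sup>2 * (a\<^sup>2 * k\<^sup>2 + 2 * k * b\<^sup>2 - b\<^sup>2) * F powr (2 * k)) / F \<and>
        (\<kappa> \<noteq> 0 \<longrightarrow>
          \<tau> = \<sigma> * (a * b * d / (\<kappa>\<^sup>2 * F powr (3 - k)) *
            (b\<^sup>2 + a\<^sup>2 * k\<^sup>2 -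
              d\<^sup>2 * (a\<^sup>2 * b\<^sup>2 + (a^4 - 2 * a\<^sup>2 * b\<^sup>2 - a\<^sup>2) * k + (2 * a\<^sup>2 - 3 * a^4) * k\<^sup>2
                + a^4 * k^3) * F powr (2 * k))))))"
proof -
  have ode: "(f has_real_derivative deriv f u) (at u)" "(g has_real_derivative deriv g u) (at u)"
    "(deriv f has_real_derivative - k * (deriv g u)\<^sup>2 / f u) (at u)"
    "(deriv g has_real_derivative k * deriv f u * deriv g u / f u) (at u)" if "u \<in> I" for u
    by (rule rot_surface_profile_ode[where I = I and f = f and g = g and k = k];
        use assms(1,3-7,9) that in blast)+
  have "connected I"
    using assms(2) is_interval_connected_1 by blast
  then obtain D where D: "\<And>u. u \<in> I \<Longrightarrow> deriv g u = D * f u powr k"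
    using powr_proportional_of_ode[where q = "deriv g" and f' = "deriv f"] assms(1,5) ode(1,4)
    by blast
  \<comment> \<open>The starting point supplies an element of \<open>I\<close>, and one nonzero
    value of \<open>g'\<close> suffices for \<open>D \<noteq> 0\<close>.\<close>
  have "deriv g (lox_s \<psi> c t0) \<noteq> 0"
    using assms(6,7)[OF assms(13)] by auto
  then have D0: "D \<noteq> 0"
    using D[OF assms(13)] by auto
  have ab: "a\<^sup>2 + b\<^sup>2 = 1"
    using assms(12,15,16) by (auto simp: power_mult_distrib)
  show ?thesis
  \<comment> \<open>Both witnesses are fixed before \<open>t\<close>, so one constant and one sign
    serve the whole curve.\<close>
  proof (intro exI[of _ "\<bar>D\<bar>"] conjI bexI[of _ "sgn D"] ballI allI impI)
    show "sgn (deriv g u) = sgn D" if "u \<in> I" for u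
      using D[OF that] assms(5)[OF that] by (simp add: sgn_mult)
    fix t assume t: "lox_s \<psi> c t \<in> I"
    define F P Q where "F = f (lox_s \<psi> c t)" and "P = deriv f (lox_s \<psi> c t)"
      and "Q = deriv g (lox_s \<psi> c t)"
    have F: "F > 0" and PQ: "P\<^sup>2 + Q\<^sup>2 = 1" and Q: "Q = D * F powr k"
      using assms(5,7) D t by (simp_all add: F_def P_def Q_def)
    have Q2: "Q\<^sup>2 = \<bar>D\<bar>\<^sup>2 * F powr (2 * k)"
      using F by (simp add: Q power_mult_distrib powr_power mult.commute)
    define \<theta> where "\<theta> = lox_theta f \<psi> \<epsilon> c t0 t"
    have derivs: "curve_deriv 1 \<alpha> t = cyl \<theta> (a * P) b (a * Q)"
      "curve_deriv 2 \<alpha> t = cyl \<theta> (- (k * a\<^sup>2 * Q\<^sup>2 + b\<^sup>2) / F) (a * b * P / F) (k * a\<^sup>2 * P * Q / F)"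
      "curve_deriv 3 \<alpha> t = cyl \<theta>
        (a * P * (k * a\<^sup>2 * Q\<^sup>2 - 2 * k\<^sup>2 * a\<^sup>2 * Q\<^sup>2) / F\<^sup>2)
        (- b * (a\<^sup>2 * P\<^sup>2 + 2 * k * a\<^sup>2 * Q\<^sup>2 + b\<^sup>2) / F\<^sup>2)
        (k * a^3 * Q * (k * P\<^sup>2 - P\<^sup>2 - k * Q\<^sup>2) / F\<^sup>2)"
      unfolding assms(14) F_def P_def Q_def \<theta>_def
      by (rule loxodrome_curve_deriv[where I = I]; use assms(1,2,5,13,15,16) ode t in blast)+
    have unit: "norm (curve_deriv 1 \<alpha> t) = 1"
    proof -
      have "(a * P)\<^sup>2 + b\<^sup>2 + (a * Q)\<^sup>2 = 1"
        using ab PQ by algebra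
      then have "(norm (curve_deriv 1 \<alpha> t))\<^sup>2 = 1"
        unfolding derivs norm_cyl_squared .
      then show ?thesis
        by (smt (verit) norm_ge_zero power2_eq_1_iff)
    qed
    have orth: "curve_deriv 1 \<alpha> t \<bullet> curve_deriv 2 \<alpha> t = 0"
    proof -
      have "a * P * (- (k * a\<^sup>2 * Q\<^sup>2 + b\<^sup>2)) + b * (a * b * P) + a * Q * (k * a\<^sup>2 * P * Q) = 0"
        by algebra
      then show ?thesis
        unfolding derivs inner_cyl times_divide_eq_right add_divide_distrib[symmetric] by simp
    qed
    note ct = curvature_of_unit_speed[OF unit orth]
    have "(norm (curve_deriv 2 \<alpha> t))\<^sup>2
        = (b\<^sup>2 + a\<^sup>2 * (a\<^sup>2 * k\<^sup>2 + 2 * k * b\<^sup>2 - b\<^sup>2) * Q\<^sup>2) / F\<^sup>2"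
      unfolding derivs norm_cyl_squared power_divide power2_minus
        add_divide_distrib[symmetric] loxodrome_curvature_identity[OF ab PQ] ..
    then have "norm (curve_deriv 2 \<alpha> t)
        = sqrt ((b\<^sup>2 + a\<^sup>2 * (a\<^sup>2 * k\<^sup>2 + 2 * k * b\<^sup>2 - b\<^sup>2) * Q\<^sup>2) / F\<^sup>2)"
      by (metis norm_ge_zero real_sqrt_unique)
    then have \<kappa>: "curvature \<alpha> t
        = sqrt (b\<^sup>2 + \<bar>D\<bar>\<^sup>2 * a\<^sup>2 * (a\<^sup>2 * k\<^sup>2 + 2 * k * b\<^sup>2 - b\<^sup>2) * F powr (2 * k)) / F"
      using F by (simp add: ct(1) real_sqrt_divide Q2 mult_ac)
    define R where "R = b\<^sup>2 + a\<^sup>2 * k\<^sup>2 - (a\<^sup>2 * b\<^sup>2 + (a^4 - 2 * a\<^sup>2 * b\<^sup>2 - a\<^sup>2) * k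
        + (2 * a\<^sup>2 - 3 * a^4) * k\<^sup>2 + a^4 * k^3) * Q\<^sup>2"
    \<comment> \<open>Here \<open>(x, v, w)\<close> are the components of the velocity,
      \<open>(u, y, z)\<close> those of the second derivative without \<open>1 / F\<close>, and
      \<open>(x', y', z')\<close> those of the third without \<open>1 / F\<^sup>2\<close>; together
      they give the factor \<open>1 / F ^ 3\<close>.\<close>
    have clear: "x * (y / F * (z' / F\<^sup>2) - z / F * (y' / F\<^sup>2)) - v * (u / F * (z' / F\<^sup>2) - z / F * (x' / F\<^sup>2))
        + w * (u / F * (y' / F\<^sup>2) - y / F * (x' / F\<^sup>2))
        = (x * (y * z' - z * y') - v * (u * z' - z * x') + w * (u * y' - y * x')) / F ^ 3"
      for x v w u y z x' y' z'
      using F by (simp add: field_simps power2_eq_square power3_eq_cube)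
    have det: "det (vector [curve_deriv 1 \<alpha> t, curve_deriv 2 \<alpha> t, curve_deriv 3 \<alpha> t] :: real^3^3)
        = a * b * Q * R / F ^ 3"
      unfolding derivs det_cyl clear R_def loxodrome_torsion_identity[OF ab PQ] ..
    \<comment> \<open>\<open>D\<close> splits into its sign and absolute value, and
      \<open>F powr k / F ^ 3\<close> is the reciprocal of \<open>F powr (3 - k)\<close>.\<close>
    have Q3: "Q / F ^ 3 = sgn D * (\<bar>D\<bar> / F powr (3 - k))"
      using F by (simp add: Q powr_diff sgn_mult_abs)
    have "a * b * Q * R / F ^ 3 = a * b * R * (Q / F ^ 3)"
      by simp
    then have \<tau>: "torsion \<alpha> t = sgn D * (a * b * \<bar>D\<bar> / ((curvature \<alpha> t)\<^sup>2 * F powr (3 - k)) * R)"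
      unfolding ct(2) det Q3 by (simp add: mult_ac)
    show "let F = f (lox_s \<psi> c t); \<kappa> = curvature \<alpha> t; \<tau> = torsion \<alpha> t in
        \<kappa> = sqrt (b\<^sup>2 + \<bar>D\<bar>\<^sup>2 * a\<^sup>2 * (a\<^sup>2 * k\<^sup>2 + 2 * k * b\<^sup>2 - b\<^sup>2) * F powr (2 * k)) / F \<and>
        (\<kappa> \<noteq> 0 \<longrightarrow>
          \<tau> = sgn D * (a * b * \<bar>D\<bar> / (\<kappa>\<^sup>2 * F powr (3 - k)) *
            (b\<^sup>2 + a\<^sup>2 * k\<^sup>2 -
              \<bar>D\<bar>\<^sup>2 * (a\<^sup>2 * b\<^sup>2 + (a^4 - 2 * a\<^sup>2 * b\<^sup>2 - a\<^sup>2) * k + (2 * a\<^sup>2 - 3 * a^4) * k\<^sup>2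
                + a^4 * k^3) * F powr (2 * k))))"
      unfolding Let_def F_def[symmetric]
      using \<kappa> \<tau> unfolding R_def Q2 by (simp only: mult_ac simp_thms)
  qed (use D0 in \<open>auto simp: sgn_if\<close>)
qed

end
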